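(* Let $\mathfrak H$, $\mathcal H$ be Krein spaces and $\mathfrak L$ a Hilbert space. Let $T$ be a densely defined, closed, symmetric operator in $\mathfrak H$, let $\Pi_\Gamma=(\mathfrak L,\Gamma_0,\Gamma_1)$ be an ordinary boundary triple for $T^+$ with $\gamma$-field $\gamma_\Gamma$ and Weyl family $M_\Gamma$. Let $V=\begin{pmatrix}A&B\\ C&D\end{pmatrix}$ (with $A,B,C,D$ bounded everywhere defined operators from $\mathfrak H$ to $\mathcal H$) be a standard unitary operator from the $\widehat J_{\mathfrak H}$-space $\mathfrak H^2$ to the $\widehat J_{\mathcal H}$-space $\mathcal H^2$ such that $0\notin\sigma_p(W(A,B;T^+))$. Let $T':=V(T)$ and let $\Pi_{\Gamma'}=(\mathfrak L,\Gamma_0',\Gamma_1')$ be the ordinary boundary triple for $T'^{+}$ given by $\Gamma_i':=\Gamma_iW(A,B;T^+)^{-1}$, $i\in\{0,1\}$. Let $T_0:=\ker\Gamma_0$, $T_0':=\ker\Gamma'_0$, $\rho_V:=\operatorname{res}T_0\cap\operatorname{res}T_0'$, and suppose $\mathbb C_*\cap\rho_V\ne\emptyset$. Then the Weyl function $M_{\Gamma'}$ corresponding to $\Pi_{\Gamma'}$ is given on $\mathfrak L$ by $$M_{\Gamma'}(z)=M_\Gamma(z)+\Delta^V_\Gamma(z),\quad z\in\rho_V,$$ $$\Delta_\Gamma^V(z):=-\Gamma_1\,p_V(z;T_0)^{-1}p_V(z)\gamma_\Gamma(z),\qquad p_V(z):=p_V(z;zI_{\mathfrak H})=z^2B+z(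A-D)-C.$$
   Context: Krein space: a Hilbert space $(\mathfrak H,\langle\cdot,\cdot\rangle)$ with a fundamental symmetry $J_{\mathfrak H}=J_{\mathfrak H}^*=J_{\mathfrak H}^{-1}$ and indefinite metric $[f,g]=\langle f,J_{\mathfrak H}g\rangle$. For a densely defined operator $T$ in $\mathfrak H$, $T^+=J_{\mathfrak H}T^*J_{\mathfrak H}$ is its Krein space adjoint ($T^*$ the Hilbert space adjoint); $T$ is symmetric if $T\subseteq T^+$. Operators are identified with their graphs; $V(T)=\{V\begin{pmatrix}f\\ Tf\end{pmatrix}:f\in\operatorname{dom}T\}\subseteq\mathcal H^2$. $\mathbb C_*=\mathbb C\setminus\mathbb R$; $\sigma_p$ and $\operatorname{res}$ denote point spectrum and resolvent set; $0\notin\sigma_p(W)$ means that the operator $W$ is injective; $\mathfrak N_z(T^+)=\ker(T^+-zI)$. $\widehat J_{\mathfrak H}=\begin{pmatrix}0&-iJ_{\mathfrak H}\\ iJ_{\mathfrak H}&0\end{pmatrix}$ on $\mathfrak H^2$, and $\widehat J_{\mathcal H}$ is defined analogously. A standard unitary operator $V$ from the $\widehat J_{\mathfrak H}$-space to the $\widehat J_{\mathcal H}$-space is a bounded everywhere defined operator $\mathfrak H^2\to\mathcal H^2$ with bounded everywhere defined inverse $V^{-1}=V^+:=\widehat J_{\mathfrak H}V^*\widehat J_{\mathcal H}$. Ordinary boundary triple $(\mathfrak L,\Gamma_0,\Gamma_1)$ for $T^+$ ($T$ a densely defined closed symmetric operator in $\mathfrak H$): linear maps $\Gamma_0,\Gamma_1:\operatorname{dom}T^+\to\mathfrak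 L$ with $[T^+f,g]-[f,T^+g]=\langle\Gamma_1f,\Gamma_0g\rangle_{\mathfrak L}-\langle\Gamma_0f,\Gamma_1g\rangle_{\mathfrak L}$ for all $f,g\in\operatorname{dom}T^+$ and $(\Gamma_0,\Gamma_1):\operatorname{dom}T^+\to\mathfrak L^2$ surjective. Here $\ker\Gamma_0$ is identified with the operator $T_0$, the restriction of $T^+$ to $\{f\in\operatorname{dom}T^+:\Gamma_0f=0\}$. The Weyl family and $\gamma$-field are $M_\Gamma(z)=\{(\Gamma_0f,\Gamma_1f):f\in\mathfrak N_z(T^+)\}$ and $\gamma_\Gamma(z)=\{(\Gamma_0f,f):f\in\mathfrak N_z(T^+)\}$; for $z\in\operatorname{res}T_0$ these are bounded everywhere defined operators on $\mathfrak L$, namely $\gamma_\Gamma(z)=(\Gamma_0|_{\mathfrak N_z(T^+)})^{-1}$, $M_\Gamma(z)=\Gamma_1\gamma_\Gamma(z)$. The same definitions apply to $\Pi_{\Gamma'}$, $T'$ and $\mathcal H$. For an operator $S$ in $\mathfrak H$, $W(A,B;S):=(A+BS)|_{\operatorname{dom}S}$ and $p_V(z;S):=zW(A,B;S)-W(C,D;S)=(zA-C+(zB-D)S)|_{\operatorname{dom}S}$. Under the hypothesis $0\notin\sigma_p(W(A,B;T^+))$, $T'$ is a densely defined closed symmetric operator in $\mathcal H$, $T'^{+}=V(T^+)=W(C,D;T^+)W(A,B;T^+)^{-1}$ with $\operatorname{dom}T'^{+}=\operatorname{ran}W(A,B;T^+)$, and $\Pi_{\Gamma'}$ is indeed an ordinary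 boundary triple for $T'^+$; moreover $z\in\operatorname{res}T_0'$ iff $p_V(z;T_0)$ has a bounded everywhere defined (on $\mathcal H$) inverse. *)

theory Defs
  imports "HOL-Analysis.Analysis"
begin

section \<open>Complex Hilbert spaces\<close>

class complex_vector = real_vector +
  fixes scaleC :: "complex \<Rightarrow> 'a \<Rightarrow> 'a"  (infixr "*\<^sub>C" 75)
  assumes scaleC_add_right: "a *\<^sub>C (x + y) = a *\<^sub>C x + a *\<^sub>C y"
    and scaleC_add_left: "(a + b) *\<^sub>C x = a *\<^sub>C x + b *\<^sub>C x"
    and scaleC_scaleC: "a *\<^sub>C (b *\<^sub>C x) = (a * b) *\<^sub>C x"
    and scaleC_one: "1 *\<^sub>C x = x"
    and scaleR_scaleC: "r *\<^sub>R x = complex_of_real r *\<^sub>C x"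

text \<open>The inner product is conjugate-linear in the first argument and linear in the second.\<close>

class complex_inner = complex_vector + real_normed_vector +
  fixes cinner :: "'a \<Rightarrow> 'a \<Rightarrow> complex"
  assumes cinner_commute: "cinner x y = cnj (cinner y x)"
    and cinner_add_right: "cinner x (y + z) = cinner x y + cinner x z"
    and cinner_scaleC_right: "cinner x (a *\<^sub>C y) = a * cinner x y"
    and cinner_self: "cinner x x = complex_of_real ((norm x)\<^sup>2)"

class chilbert_space = complex_inner + complete_space

text \<open>The orthogonal sum of two Hilbert spaces. Its norm is the one that the product type
  already carries.\<close>

instantiation prod :: (complex_vector, complex_vector) complex_vector
begin
definition scaleC_prod_def: "a *\<^sub>C p = (a *\<^sub>C fst p, a *\<^sub>C snd p)"
instance
  by standard
    (auto simp: scaleC_prod_def scaleR_prod_def scaleC_add_right scaleC_add_left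
      scaleC_scaleC scaleC_one scaleR_scaleC)
end

instantiation prod :: (complex_inner, complex_inner) complex_inner
begin
definition cinner_prod_def: "cinner p q = cinner (fst p) (fst q) + cinner (snd p) (snd q)"
instance
proof
  fix x y z :: "'a \<times> 'b" and a :: complex
  show "cinner x y = cnj (cinner y x)"
    by (simp add: cinner_prod_def flip: cinner_commute)
  show "cinner x (y + z) = cinner x y + cinner x z"
    by (simp add: cinner_prod_def cinner_add_right)
  show "cinner x (a *\<^sub>C y) = a * cinner x y"
    by (simp add: cinner_prod_def scaleC_prod_def cinner_scaleC_right distrib_left)
  show "cinner x x = complex_of_real ((norm x)\<^sup>2)"
    by (simp add: cinner_prod_def cinner_self norm_prod_def)
qed
end

instance prod :: (chilbert_space, chilbert_space) chilbert_space ..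

definition bounded_clinear :: "('a::complex_inner \<Rightarrow> 'b::complex_inner) \<Rightarrow> bool" where
  "bounded_clinear F \<longleftrightarrow> bounded_linear F \<and> (\<forall>a x. F (a *\<^sub>C x) = a *\<^sub>C F x)"

section \<open>Operators as graphs\<close>

text \<open>Partially defined linear operators are identified with their graphs, so that \<open>Domain\<close>,
  the inverse \<open>R\<inverse>\<close> and inclusion are the set-theoretic ones. The product \<open>S R\<close> (first \<open>R\<close>,
  then \<open>S\<close>) is \<open>R O S\<close>.\<close>

definition csubspace :: "'a::complex_vector set \<Rightarrow> bool" where
  "csubspace X \<longleftrightarrow> 0 \<in> X \<and> (\<forall>x\<in>X. \<forall>y\<in>X. x + y \<in> X) \<and> (\<forall>a. \<forall>x\<in>X. a *\<^sub>C x \<in> X)"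

definition linear_op :: "('a::complex_vector \<times> 'b::complex_vector) set \<Rightarrow> bool" where
  "linear_op R \<longleftrightarrow> csubspace R \<and> single_valued R"

definition graph_of :: "('a \<Rightarrow> 'b) \<Rightarrow> ('a \<times> 'b) set" where
  "graph_of F = {(x, F x) | x. True}"

definition bounded_everywhere_defined :: "('a::complex_inner \<times> 'b::complex_inner) set \<Rightarrow> bool" where
  "bounded_everywhere_defined R \<longleftrightarrow> (\<exists>F. bounded_clinear F \<and> R = graph_of F)"

definition rel_add :: "('a \<times> 'b::plus) set \<Rightarrow> ('a \<times> 'b) set \<Rightarrow> ('a \<times> 'b) set" where
  "rel_add R S = {(x, y + y') | x y y'. (x, y) \<in> R \<and> (x, y') \<in> S}"

definition rel_scale :: "complex \<Rightarrow> ('a \<times> 'b::complex_vector) set \<Rightarrow> ('a \<times> 'b) set" where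
  "rel_scale c R = {(x, c *\<^sub>C y) | x y. (x, y) \<in> R}"

definition rel_minus :: "('a \<times> 'b::complex_vector) set \<Rightarrow> ('a \<times> 'b) set" where
  "rel_minus R = {(x, - y) | x y. (x, y) \<in> R}"

definition densely_defined :: "('a::topological_space \<times> 'b) set \<Rightarrow> bool" where
  "densely_defined R \<longleftrightarrow> closure (Domain R) = UNIV"

definition eigenspace :: "('a::complex_vector \<times> 'a) set \<Rightarrow> complex \<Rightarrow> 'a set" where
  "eigenspace S z = {f. (f, z *\<^sub>C f) \<in> S}"

definition resolvent_set :: "('a::complex_inner \<times> 'a) set \<Rightarrow> complex set" where
  "resolvent_set S =
    {z. bounded_everywhere_defined ((rel_add S (rel_minus (graph_of (\<lambda>f. z *\<^sub>C f))))\<inverse>)}"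

text \<open>Hilbert space adjoint; for densely defined \<open>R\<close> it is again (the graph of) an operator.\<close>

definition hilbert_adj :: "('a::complex_inner \<times> 'b::complex_inner) set \<Rightarrow> ('b \<times> 'a) set" where
  "hilbert_adj R = {(g, g'). \<forall>(f, f') \<in> R. cinner f' g = cinner f g'}"

section \<open>Krein spaces\<close>

definition fundamental_symmetry :: "('a::complex_inner \<Rightarrow> 'a) \<Rightarrow> bool" where
  "fundamental_symmetry J \<longleftrightarrow> bounded_clinear J \<and>
     graph_of J = hilbert_adj (graph_of J) \<and> graph_of J = (graph_of J)\<inverse>"

definition indef_metric :: "('a::complex_inner \<Rightarrow> 'a) \<Rightarrow> 'a \<Rightarrow> 'a \<Rightarrow> complex" where
  "indef_metric J f g = cinner f (J g)"

text \<open>For \<open>R\<close> from the \<open>J\<^sub>1\<close>-space to the \<open>J\<^sub>2\<close>-space this is \<open>R\<^sup>+ = J\<^sub>1 R\<^sup>* J\<^sub>2\<close>.\<close>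

definition krein_adj ::
  "('a::complex_inner \<Rightarrow> 'a) \<Rightarrow> ('b::complex_inner \<Rightarrow> 'b) \<Rightarrow> ('a \<times> 'b) set \<Rightarrow> ('b \<times> 'a) set" where
  "krein_adj J1 J2 R = graph_of J2 O hilbert_adj R O graph_of J1"

definition krein_symmetric :: "('a::complex_inner \<Rightarrow> 'a) \<Rightarrow> ('a \<times> 'a) set \<Rightarrow> bool" where
  "krein_symmetric J T \<longleftrightarrow> T \<subseteq> krein_adj J J T"

definition J_hat :: "('a::complex_vector \<Rightarrow> 'a) \<Rightarrow> 'a \<times> 'a \<Rightarrow> 'a \<times> 'a" where
  "J_hat J = (\<lambda>(f, f'). (- (\<i> *\<^sub>C J f'), \<i> *\<^sub>C J f))"

definition block_op ::
  "('a \<Rightarrow> 'b) \<Rightarrow> ('a \<Rightarrow> 'b) \<Rightarrow> ('a \<Rightarrow> 'b) \<Rightarrow> ('a \<Rightarrow> 'b::plus) \<Rightarrow> 'a \<times> 'a \<Rightarrow> 'b \<times> 'b" where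
  "block_op A B C D = (\<lambda>(f, f'). (A f + B f', C f + D f'))"

definition standard_unitary ::
  "('a::complex_inner \<Rightarrow> 'a) \<Rightarrow> ('b::complex_inner \<Rightarrow> 'b) \<Rightarrow> ('a \<times> 'a \<Rightarrow> 'b \<times> 'b) \<Rightarrow> bool" where
  "standard_unitary JH JK V \<longleftrightarrow> bounded_clinear V \<and>
     bounded_everywhere_defined ((graph_of V)\<inverse>) \<and>
     (graph_of V)\<inverse> = krein_adj (J_hat JH) (J_hat JK) (graph_of V)"

section \<open>Boundary triples\<close>

text \<open>The operators \<open>\<Gamma>\<^sub>0\<close>, \<open>\<Gamma>\<^sub>1\<close> are graphs as well, with domain \<open>dom T\<^sup>+\<close>. The boundary
  space is the type \<open>'l\<close>.\<close>

definition boundary_triple ::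
  "('a::chilbert_space \<Rightarrow> 'a) \<Rightarrow> ('a \<times> 'a) set \<Rightarrow> ('a \<times> 'l::chilbert_space) set \<Rightarrow> ('a \<times> 'l) set
    \<Rightarrow> bool" where
  "boundary_triple J T G0 G1 \<longleftrightarrow>
     linear_op G0 \<and> linear_op G1 \<and>
     Domain G0 = Domain (krein_adj J J T) \<and> Domain G1 = Domain (krein_adj J J T) \<and>
     (\<forall>f f' g g' a0 a1 b0 b1.
        (f, f') \<in> krein_adj J J T \<and> (g, g') \<in> krein_adj J J T \<and>
        (f, a0) \<in> G0 \<and> (f, a1) \<in> G1 \<and> (g, b0) \<in> G0 \<and> (g, b1) \<in> G1 \<longrightarrow>
        indef_metric J f' g - indef_metric J f g' = cinner a1 b0 - cinner a0 b1) \<and>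
     (\<forall>a b. \<exists>f. (f, a) \<in> G0 \<and> (f, b) \<in> G1)"

definition restrict_ker :: "('a \<times> 'b) set \<Rightarrow> ('a \<times> 'l::zero) set \<Rightarrow> ('a \<times> 'b) set" where
  "restrict_ker S G0 = {(f, f') \<in> S. (f, 0) \<in> G0}"

definition weyl_family ::
  "('a::complex_vector \<times> 'a) set \<Rightarrow> ('a \<times> 'l) set \<Rightarrow> ('a \<times> 'l) set \<Rightarrow> complex \<Rightarrow> ('l \<times> 'l) set" where
  "weyl_family S G0 G1 z = {(a, b). \<exists>f \<in> eigenspace S z. (f, a) \<in> G0 \<and> (f, b) \<in> G1}"

definition gamma_field ::
  "('a::complex_vector \<times> 'a) set \<Rightarrow> ('a \<times> 'l) set \<Rightarrow> complex \<Rightarrow> ('l \<times> 'a) set" where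
  "gamma_field S G0 z = {(a, f). f \<in> eigenspace S z \<and> (f, a) \<in> G0}"

section \<open>The transformed triple\<close>

definition W_op :: "('a \<Rightarrow> 'b) \<Rightarrow> ('a \<Rightarrow> 'b) \<Rightarrow> ('a \<times> 'a) set \<Rightarrow> ('a \<times> 'b::plus) set" where
  "W_op A B S = {(f, A f + B f') | f f'. (f, f') \<in> S}"

definition pV_op ::
  "('a \<Rightarrow> 'b) \<Rightarrow> ('a \<Rightarrow> 'b) \<Rightarrow> ('a \<Rightarrow> 'b) \<Rightarrow> ('a \<Rightarrow> 'b) \<Rightarrow> complex \<Rightarrow> ('a \<times> 'a) set
    \<Rightarrow> ('a \<times> 'b::complex_vector) set" where
  "pV_op A B C D z S = rel_add (rel_scale z (W_op A B S)) (rel_minus (W_op C D S))"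

definition pV ::
  "('a::complex_vector \<Rightarrow> 'b) \<Rightarrow> ('a \<Rightarrow> 'b) \<Rightarrow> ('a \<Rightarrow> 'b) \<Rightarrow> ('a \<Rightarrow> 'b) \<Rightarrow> complex
    \<Rightarrow> ('a \<times> 'b::complex_vector) set" where
  "pV A B C D z = pV_op A B C D z (graph_of (\<lambda>f. z *\<^sub>C f))"

lemma pV_explicit:
  assumes "bounded_clinear A" "bounded_clinear B" "bounded_clinear C" "bounded_clinear D"
  shows "pV A B C D z = graph_of (\<lambda>f. z\<^sup>2 *\<^sub>C B f + z *\<^sub>C (A f - D f) - C f)"
proof -
  have neg: "w *\<^sub>C (- y) = - (w *\<^sub>C y)" for w and y :: 'b
  proof -
    have "w *\<^sub>C (0::'b) = 0"
      using scaleC_add_right[of w "0::'b" "0::'b"] by simp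
    then show ?thesis
      using scaleC_add_right[of w y "- y"] by (simp add: eq_neg_iff_add_eq_0 add.commute)
  qed
  have "z *\<^sub>C (A f + B (z *\<^sub>C f)) + - (C f + D (z *\<^sub>C f))
        = z\<^sup>2 *\<^sub>C B f + z *\<^sub>C (A f - D f) - C f" for f
    using assms scaleC_add_right[of z "A f" "- D f"]
    by (simp add: bounded_clinear_def scaleC_add_right scaleC_scaleC power2_eq_square neg)
  then show ?thesis
    unfolding pV_def pV_op_def W_op_def rel_add_def rel_scale_def rel_minus_def graph_of_def
    by auto
qed

text \<open>The operator \<open>- \<Gamma>\<^sub>1 p\<^sub>V(z;T\<^sub>0)\<inverse> p\<^sub>V(z) \<gamma>(z)\<close>, where \<open>S = T\<^sup>+\<close>.\<close>

definition Delta_V ::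
  "('a::complex_vector \<Rightarrow> 'b) \<Rightarrow> ('a \<Rightarrow> 'b) \<Rightarrow> ('a \<Rightarrow> 'b) \<Rightarrow> ('a \<Rightarrow> 'b::complex_vector)
    \<Rightarrow> ('a \<times> 'a) set \<Rightarrow> ('a \<times> 'l::complex_vector) set \<Rightarrow> ('a \<times> 'l) set \<Rightarrow> complex
    \<Rightarrow> ('l \<times> 'l) set" where
  "Delta_V A B C D S G0 G1 z =
     rel_minus (gamma_field S G0 z O pV A B C D z O
                (pV_op A B C D z (restrict_ker S G0))\<inverse> O G1)"

end

theory Submission
  imports Defs
begin

text \<open>A Krein space adjoint is an orthogonal complement with respect to \<open>J_hat\<close>, so a standard
  unitary \<open>V\<close> satisfies \<open>V(T)\<^sup>+ = V(T\<^sup>+)\<close>. With \<open>W = W(A,B;T\<^sup>+)\<close>, an eigenvector of \<open>T'\<^sup>+\<close>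
  at \<open>z\<close> is then \<open>W g\<close> for some \<open>g\<close> in the kernel of \<open>p\<^sub>V(z;T\<^sup>+)\<close>, and \<open>W\<close> carries the
  boundary values over unchanged. Two elements of \<open>dom T\<^sup>+\<close> with the same value of \<open>\<Gamma>\<^sub>0\<close> differ
  by an element of \<open>dom T\<^sub>0\<close>, on which \<open>p\<^sub>V(z;T\<^sub>0)\<close> is bijective because \<open>z\<close> lies in the
  resolvent set of \<open>T\<^sub>0' = V(T\<^sub>0)\<close>. Correcting \<open>f = \<gamma>(z) a\<close> by \<open>u = p\<^sub>V(z;T\<^sub>0)\<inverse> p\<^sub>V(z) f\<close>
  therefore yields the unique such \<open>g = f - u\<close> with \<open>\<Gamma>\<^sub>0 g = a\<close>.\<close>

section \<open>Complex scalars, inner products and orthogonality\<close>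

lemma scaleC_zero_right [simp]: "c *\<^sub>C (0::'a::complex_vector) = 0"
  using scaleC_add_right[of c "0::'a" 0] by simp

lemma scaleC_minus_right [simp]: "c *\<^sub>C (- x) = - (c *\<^sub>C (x::'a::complex_vector))"
  using scaleC_add_right[of c x "- x"] by (simp add: eq_neg_iff_add_eq_0 add.commute)

lemma scaleC_diff_right: "c *\<^sub>C (x - y) = c *\<^sub>C x - c *\<^sub>C (y::'a::complex_vector)"
  using scaleC_add_right[of c x "- y"] by simp

lemma scaleC_minus_one: "(- 1) *\<^sub>C x = - (x::'a::complex_vector)"
  using scaleR_scaleC[of "-1" x] by simp

lemma cinner_zero_right [simp]: "cinner x 0 = 0"
  using cinner_add_right[of x 0 0] by simp

lemma cinner_minus_right [simp]: "cinner x (- y) = - cinner x y"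
  using cinner_add_right[of x y "- y"] by (simp add: eq_neg_iff_add_eq_0 add.commute)

lemma cinner_diff_right: "cinner x (y - z) = cinner x y - cinner x z"
  using cinner_add_right[of x y "- z"] by simp

lemma cinner_diff_left: "cinner (x - y) z = cinner x z - cinner y z"
  by (metis cinner_commute cinner_diff_right complex_cnj_diff)

lemma norm_diff_orthogonal:
  assumes "cinner x y = 0"
  shows "(norm (x - y))\<^sup>2 = (norm x)\<^sup>2 + (norm y)\<^sup>2"
proof -
  have "cinner y x = 0"
    using assms cinner_commute[of y x] by simp
  then have "complex_of_real ((norm (x - y))\<^sup>2) = complex_of_real ((norm x)\<^sup>2 + (norm y)\<^sup>2)"
    using assms unfolding of_real_add cinner_self[symmetric]
    by (simp add: cinner_diff_left cinner_diff_right)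
  then show ?thesis
    using of_real_eq_iff by blast
qed

text \<open>By Pythagoras every point of \<open>X\<close> has distance at least
  \<open>norm y\<close> from \<open>y\<close>, which density forbids unless \<open>y = 0\<close>.
  This argument bypasses continuity of the inner product.\<close>

lemma orthogonal_dense_eq_zero:
  fixes y :: "'a::complex_inner"
  assumes "closure X = UNIV" "\<And>x. x \<in> X \<Longrightarrow> cinner x y = 0"
  shows "y = 0"
proof (rule ccontr)
  assume "y \<noteq> 0"
  then obtain x where x: "x \<in> X" "dist x y < norm y"
    using assms(1) closure_approachable[of y X] zero_less_norm_iff[of y] by blast
  have "(norm y)\<^sup>2 \<le> (norm (x - y))\<^sup>2"
    using norm_diff_orthogonal[of x y] assms(2) x(1) by simp
  then have "norm y \<le> norm (x - y)"
    by simp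
  with x(2) show False
    by (simp add: dist_norm)
qed

section \<open>Linear relations and bounded operators\<close>

lemma csubspace_diff:
  assumes "csubspace X" "x \<in> X" "y \<in> X"
  shows "x - y \<in> X"
proof -
  have "(- 1) *\<^sub>C y \<in> X"
    using assms by (auto simp: csubspace_def)
  then have "x + (- 1) *\<^sub>C y \<in> X"
    using assms by (auto simp: csubspace_def)
  then show ?thesis
    by (simp add: scaleC_minus_one)
qed

lemma csubspace_graph_diff:
  assumes "csubspace R" "(x, y) \<in> R" "(x', y') \<in> R"
  shows "(x - x', y - y') \<in> R"
  using csubspace_diff[OF assms] by simp

lemma csubspace_graph_add:
  assumes "csubspace R" "(x, y) \<in> R" "(x', y') \<in> R"
  shows "(x + x', y + y') \<in> R"
  using assms by (force simp: csubspace_def)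

lemma csubspace_graph_scaleC:
  assumes "csubspace R" "(x, y) \<in> R"
  shows "(c *\<^sub>C x, c *\<^sub>C y) \<in> R"
  using assms by (force simp: csubspace_def scaleC_prod_def)

lemma csubspace_graph_zero:
  assumes "csubspace R"
  shows "(0, 0) \<in> R"
  using assms by (simp add: csubspace_def zero_prod_def)

lemma csubspace_graphI:
  assumes "(0, 0) \<in> R"
    and "\<And>x y x' y'. (x, y) \<in> R \<Longrightarrow> (x', y') \<in> R \<Longrightarrow> (x + x', y + y') \<in> R"
    and "\<And>c x y. (x, y) \<in> R \<Longrightarrow> (c *\<^sub>C x, c *\<^sub>C y) \<in> R"
  shows "csubspace R"
  using assms by (auto simp: csubspace_def zero_prod_def scaleC_prod_def)

lemma bounded_clinear_add: "bounded_clinear F \<Longrightarrow> F (x + y) = F x + F y"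
  by (simp add: bounded_clinear_def linear_simps)

lemma bounded_clinear_diff: "bounded_clinear F \<Longrightarrow> F (x - y) = F x - F y"
  by (simp add: bounded_clinear_def linear_simps)

lemma bounded_clinear_zero: "bounded_clinear F \<Longrightarrow> F 0 = 0"
  by (simp add: bounded_clinear_def linear_simps)

lemma bounded_clinear_minus: "bounded_clinear F \<Longrightarrow> F (- x) = - F x"
  by (simp add: bounded_clinear_def linear_simps)

lemma bounded_clinear_scaleC: "bounded_clinear F \<Longrightarrow> F (c *\<^sub>C x) = c *\<^sub>C F x"
  by (simp add: bounded_clinear_def)

section \<open>Graphs and resolvent sets\<close>

lemma mem_graph_of [simp]: "(x, y) \<in> graph_of F \<longleftrightarrow> y = F x"
  by (auto simp: graph_of_def)

lemma mem_rel_minus: "(x, y) \<in> rel_minus R \<longleftrightarrow> (x, - y) \<in> (R :: ('a \<times> 'b::complex_vector) set)"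
  by (auto simp: rel_minus_def) (metis minus_minus)

lemma mem_resolvent_difference:
  "(y, x) \<in> (rel_add S (rel_minus (graph_of (\<lambda>f. z *\<^sub>C f))))\<inverse> \<longleftrightarrow> (x, y + z *\<^sub>C x) \<in> S"
proof -
  have "(\<exists>s t. y = s + t \<and> (x, s) \<in> S \<and> - t = z *\<^sub>C x) \<longleftrightarrow> (x, y + z *\<^sub>C x) \<in> S"
    by (metis add_diff_cancel_right' diff_add_cancel diff_minus_eq_add minus_minus uminus_add_conv_diff)
  then show ?thesis
    by (simp add: rel_add_def mem_rel_minus)
qed

text \<open>The inverse of \<open>S - z\<close> is the graph of a total function, so the equation (S
  - z) x = y has exactly one solution. It is written as membership in \<open>S\<close> so that
  linear relations can be subtracted directly.\<close>

lemma resolvent_set_bijective: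
  assumes "z \<in> resolvent_set S"
  shows "\<exists>!x. (x, y + z *\<^sub>C x) \<in> S"
proof -
  obtain F where "(rel_add S (rel_minus (graph_of (\<lambda>f. z *\<^sub>C f))))\<inverse> = graph_of F"
    using assms by (auto simp: resolvent_set_def bounded_everywhere_defined_def)
  then have "(x, y + z *\<^sub>C x) \<in> S \<longleftrightarrow> x = F y" for x
    by (metis mem_resolvent_difference mem_graph_of)
  then show ?thesis
    by auto
qed

section \<open>Krein space adjoints and standard unitary operators\<close>

lemma fundamental_symmetry_involution:
  assumes "fundamental_symmetry J"
  shows "J (J x) = x"
  using assms mem_graph_of[of x "J x" J]
  by (metis fundamental_symmetry_def converse_iff mem_graph_of)

lemma J_hat_involution:
  assumes "fundamental_symmetry J"
  shows "J_hat J (J_hat J p) = p"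
proof -
  have "bounded_clinear J"
    using assms by (simp add: fundamental_symmetry_def)
  then show ?thesis
    by (cases p) (simp add: J_hat_def fundamental_symmetry_involution[OF assms]
        bounded_clinear_scaleC bounded_clinear_minus scaleC_scaleC scaleC_minus_one)
qed

text \<open>Composing with the graph of an involution amounts to substituting \<open>J1 g'\<close>.
  Only the involution law is assumed, so the rule serves both for a fundamental symmetry
  \<open>J\<close> and for \<open>J_hat J\<close>.\<close>

lemma mem_krein_adj:
  assumes "\<And>x. J1 (J1 x) = x"
  shows "(g, g') \<in> krein_adj J1 J2 R \<longleftrightarrow> (\<forall>(f, f') \<in> R. cinner f' (J2 g) = cinner f (J1 g'))"
proof -
  have "(g, g') \<in> krein_adj J1 J2 R \<longleftrightarrow> (J2 g, J1 g') \<in> hilbert_adj R"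
    unfolding krein_adj_def relcomp_unfold using assms by auto
  then show ?thesis
    by (simp add: hilbert_adj_def)
qed

text \<open>For q = (f, f') and p = (g, g') the inner product is i times the difference of
  \<open>cinner f' (J g)\<close> and \<open>cinner f (J g')\<close>, so its vanishing is the adjoint
  identity.\<close>

lemma mem_krein_adj_J_hat:
  assumes "fundamental_symmetry J"
  shows "p \<in> krein_adj J J R \<longleftrightarrow> (\<forall>q \<in> R. cinner q (J_hat J p) = 0)"
  by (cases p) (auto simp: mem_krein_adj[OF fundamental_symmetry_involution[OF assms]]
      J_hat_def cinner_prod_def cinner_scaleC_right)

text \<open>Single-valuedness comes from density: if g' and g'' are both values at g, then
  \<open>J g' - J g''\<close> is orthogonal to \<open>Domain T\<close>, and \<open>J\<close> is
  injective.\<close>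

lemma linear_op_krein_adj:
  assumes J: "fundamental_symmetry J" and "densely_defined T"
  shows "linear_op (krein_adj J J T)"
proof -
  have lin: "bounded_clinear J"
    using J by (simp add: fundamental_symmetry_def)
  note mem = mem_krein_adj[OF fundamental_symmetry_involution[OF J]]
  have "csubspace (krein_adj J J T)"
    by (rule csubspace_graphI)
      (fastforce simp: mem bounded_clinear_add[OF lin] bounded_clinear_zero[OF lin]
        bounded_clinear_scaleC[OF lin] cinner_add_right cinner_scaleC_right)+
  moreover have "single_valued (krein_adj J J T)"
  proof (rule single_valuedI)
    fix g g' g'' assume "(g, g') \<in> krein_adj J J T" "(g, g'') \<in> krein_adj J J T"
    then have "cinner f (J g' - J g'') = 0" if "f \<in> Domain T" for f
      using that by (fastforce simp: mem cinner_diff_right)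
    then have "J g' - J g'' = 0"
      using assms(2) by (intro orthogonal_dense_eq_zero) (auto simp: densely_defined_def)
    then show "g' = g''"
      using fundamental_symmetry_involution[OF J] by (metis eq_iff_diff_eq_0)
  qed
  ultimately show ?thesis
    by (simp add: linear_op_def)
qed

lemma standard_unitary_surj:
  assumes "standard_unitary JH JK V"
  shows "surj V"
proof -
  obtain F where "(graph_of V)\<inverse> = graph_of F"
    using assms unfolding standard_unitary_def bounded_everywhere_defined_def by blast
  then have "V (F y) = y" for y
    by (metis converse_iff mem_graph_of)
  then show ?thesis
    by (metis surjI)
qed

text \<open>This is the identity between inverse and adjoint of \<open>V\<close>, read at the pair
  \<open>(V q, q)\<close> and tested against \<open>(p, V p)\<close>.\<close>

lemma standard_unitary_isometry:
  assumes "fundamental_symmetry JH" "standard_unitary JH JK V"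
  shows "cinner (V p) (J_hat JK (V q)) = cinner p (J_hat JH q)"
proof -
  have "(V q, q) \<in> (graph_of V)\<inverse>"
    by simp
  then have "(V q, q) \<in> krein_adj (J_hat JH) (J_hat JK) (graph_of V)"
    using assms(2) unfolding standard_unitary_def by metis
  then show ?thesis
    using mem_graph_of[of p "V p" V]
    unfolding mem_krein_adj[OF J_hat_involution[OF assms(1)]] by blast
qed

lemma krein_adj_image_standard_unitary:
  assumes "fundamental_symmetry JH" "fundamental_symmetry JK" "standard_unitary JH JK V"
  shows "krein_adj JK JK (V ` T) = V ` krein_adj JH JH T"
proof -
  have "V -` krein_adj JK JK (V ` T) = krein_adj JH JH T"
    by (intro set_eqI)
      (simp add: mem_krein_adj_J_hat assms standard_unitary_isometry[OF assms(1,3)])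
  then show ?thesis
    using surj_image_vimage_eq[OF standard_unitary_surj[OF assms(3)]] by metis
qed

section \<open>The pencil \<open>pV_op\<close> and the setting at a fixed point z\<close>

lemma mem_pV_op:
  assumes "single_valued S"
  shows "(f, k) \<in> pV_op A B C D z S \<longleftrightarrow>
    (\<exists>f'. (f, f') \<in> S \<and> k = z *\<^sub>C (A f + B f') - (C f + D f'))"
proof -
  have "(f, k) \<in> pV_op A B C D z S \<longleftrightarrow>
    (\<exists>f' f''. (f, f') \<in> S \<and> (f, f'') \<in> S \<and> k = z *\<^sub>C (A f + B f') - (C f + D f''))"
    unfolding pV_op_def W_op_def rel_add_def rel_scale_def rel_minus_def diff_conv_add_uminus
    by blast
  then show ?thesis
    using single_valuedD[OF assms] by metis
qed

text \<open>Here \<open>S\<close> stands for the adjoint of T, and its image under the block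
  operator for the adjoint of T'. The rest of the argument is then pure algebra of linear relations,
  with T_0 and T_0' entering through bijectivity of T_0 - z and T_0' - z.\<close>

locale transformed_triple =
  fixes S :: "('h::chilbert_space \<times> 'h) set"
    and G0 G1 :: "('h \<times> 'l::chilbert_space) set"
    and A B C D :: "'h \<Rightarrow> 'k::chilbert_space"
    and z :: complex
  assumes S: "linear_op S" and G0: "linear_op G0" and G1: "linear_op G1"
    and dom_G0: "Domain G0 = Domain S" and dom_G1: "Domain G1 = Domain S"
    and surj_G0: "\<And>a. \<exists>f. (f, a) \<in> G0"
    and A: "bounded_clinear A" and B: "bounded_clinear B"
    and C: "bounded_clinear C" and D: "bounded_clinear D"
    and W_inj: "single_valued ((W_op A B S)\<inverse>)"
    and res: "z \<in> resolvent_set (restrict_ker S G0)"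
    and res': "z \<in> resolvent_set
      (restrict_ker (block_op A B C D ` S) ((W_op A B S)\<inverse> O G0))"
begin

text \<open>Keeping f' as an independent argument makes \<open>P\<close> linear on pairs and covers
  both pencils: f' a value of \<open>S\<close> gives \<open>pV_op\<close>, and f' = z f gives
  \<open>pV\<close>.\<close>

definition P :: "'h \<Rightarrow> 'h \<Rightarrow> 'k" where
  "P f f' = z *\<^sub>C (A f + B f') - (C f + D f')"

lemma P_diff: "P (f - g) (f' - g') = P f f' - P g g'"
  by (simp add: P_def A B C D bounded_clinear_diff scaleC_diff_right scaleC_add_right)

lemma P_add: "P (f + g) (f' + g') = P f f' + P g g'"
  by (simp add: P_def A B C D bounded_clinear_add scaleC_add_right)

lemma P_scaleC: "P (c *\<^sub>C f) (c *\<^sub>C f') = c *\<^sub>C P f f'"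
  by (simp add: P_def A B C D bounded_clinear_scaleC scaleC_add_right scaleC_diff_right
      scaleC_scaleC mult.commute)

lemma P_zero: "P 0 0 = 0"
  by (simp add: P_def A B C D bounded_clinear_zero)

lemma S_sub: "csubspace S" and S_fun: "(f, x) \<in> S \<Longrightarrow> (f, y) \<in> S \<Longrightarrow> x = y"
  using S by (auto simp: linear_op_def dest: single_valuedD)

lemma G0_sub: "csubspace G0" and G0_fun: "(f, a) \<in> G0 \<Longrightarrow> (f, b) \<in> G0 \<Longrightarrow> a = b"
  using G0 by (auto simp: linear_op_def dest: single_valuedD)

lemma G1_sub: "csubspace G1" and G1_fun: "(f, a) \<in> G1 \<Longrightarrow> (f, b) \<in> G1 \<Longrightarrow> a = b"
  using G1 by (auto simp: linear_op_def dest: single_valuedD)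

lemma W_injD:
  "(f, f') \<in> S \<Longrightarrow> (g, g') \<in> S \<Longrightarrow> A f + B f' = A g + B g' \<Longrightarrow> f = g"
  using W_inj unfolding single_valued_def W_op_def by fastforce

text \<open>Injectivity of W makes f the only element that W sends to \<open>A f + B f'\<close>. The
  relation \<open>G\<close> is arbitrary, so this applies to \<open>G0\<close> and \<open>G1\<close>
  alike.\<close>

lemma mem_transformed_boundary:
  assumes "(f, f') \<in> S"
  shows "(A f + B f', a) \<in> (W_op A B S)\<inverse> O G \<longleftrightarrow> (f, a) \<in> G"
  using assms W_injD unfolding W_op_def by fastforce

section \<open>Consequences of z lying in both resolvent sets\<close>

lemma T0_eigen_zero:
  assumes "(f, z *\<^sub>C f) \<in> S" "(f, 0) \<in> G0"
  shows "f = 0"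
  using resolvent_set_bijective[OF res, of 0] assms
    csubspace_graph_zero[OF S_sub] csubspace_graph_zero[OF G0_sub]
  by (auto simp: restrict_ker_def)

text \<open>On dom T_0 the pencil factors as (z - T_0') W. Solving (T_0' - z) h = -k and pulling h
  back along W gives the required f.\<close>

lemma P_surj: "\<exists>f f'. (f, f') \<in> S \<and> (f, 0) \<in> G0 \<and> P f f' = k"
proof -
  obtain h where h: "(h, - k + z *\<^sub>C h) \<in>
      restrict_ker (block_op A B C D ` S) ((W_op A B S)\<inverse> O G0)"
    using resolvent_set_bijective[OF res', of "- k"] by blast
  then obtain f f' where f: "(f, f') \<in> S" "h = A f + B f'" "- k + z *\<^sub>C h = C f + D f'"
    by (auto simp: restrict_ker_def block_op_def)
  have "(f, 0) \<in> G0"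
    using h mem_transformed_boundary[OF f(1), of 0 G0] by (simp add: restrict_ker_def flip: f(2))
  moreover have "P f f' = k"
    using f(3) unfolding P_def f(2) by (simp add: algebra_simps)
  ultimately show ?thesis
    using f(1) by blast
qed

text \<open>By the same factorization, W f lies in the kernel of T_0' - z, hence vanishes, and W is
  injective.\<close>

lemma P_inj:
  assumes f: "(f, f') \<in> S" "(f, 0) \<in> G0" "P f f' = 0"
  shows "f = 0"
proof -
  let ?T0' = "restrict_ker (block_op A B C D ` S) ((W_op A B S)\<inverse> O G0)"
  have mem: "(A g + B g', 0 + z *\<^sub>C (A g + B g')) \<in> ?T0'"
    if "(g, g') \<in> S" "(g, 0) \<in> G0" "P g g' = 0" for g g'
  proof -
    have "(A g + B g', C g + D g') \<in> block_op A B C D ` S"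
      using that(1) by (force simp: block_op_def)
    then show ?thesis
      using that(2,3) by (simp add: restrict_ker_def P_def mem_transformed_boundary[OF that(1)])
  qed
  have z: "(0, 0) \<in> S" "(0, 0) \<in> G0"
    using csubspace_graph_zero S_sub G0_sub by blast+
  \<comment> \<open>The zero pair provides a second solution of the homogeneous equation, so
    uniqueness identifies the two.\<close>
  have "A f + B f' = A 0 + B 0"
    using resolvent_set_bijective[OF res', of 0] mem[OF f] mem[OF z P_zero] by blast
  then show ?thesis
    using W_injD f(1) z(1) by blast
qed

text \<open>Start from any g with boundary value a and subtract the u in dom T_0 that solves (T_0 -
  z) u = (S - z) g. The difference is an eigenvector of \<open>S\<close> at z, and \<open>G0\<close>
  does not see u.\<close>

lemma gamma_exists: "\<exists>f. (f, z *\<^sub>C f) \<in> S \<and> (f, a) \<in> G0"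
proof -
  obtain g where g: "(g, a) \<in> G0"
    using surj_G0 by blast
  then obtain g' where g': "(g, g') \<in> S"
    using dom_G0 by blast
  obtain u where u: "(u, (g' - z *\<^sub>C g) + z *\<^sub>C u) \<in> S" "(u, 0) \<in> G0"
    using resolvent_set_bijective[OF res, of "g' - z *\<^sub>C g"] by (auto simp: restrict_ker_def)
  have "(g - u, z *\<^sub>C (g - u)) \<in> S"
    using csubspace_graph_diff[OF S_sub g' u(1)] by (simp add: scaleC_diff_right algebra_simps)
  moreover have "(g - u, a) \<in> G0"
    using csubspace_graph_diff[OF G0_sub g u(2)] by simp
  ultimately show ?thesis
    by blast
qed

section \<open>The Weyl family of the transformed triple\<close>

abbreviation M' :: "('l \<times> 'l) set" where
  "M' \<equiv> weyl_family (block_op A B C D ` S)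
    ((W_op A B S)\<inverse> O G0) ((W_op A B S)\<inverse> O G1) z"

text \<open>Writing an eigenvector of the transformed operator as h = W f turns its eigenvalue
  equation into \<open>P f f' = 0\<close>, so \<open>M'\<close> is described entirely in the
  original space.\<close>

lemma mem_M':
  "(a, b) \<in> M' \<longleftrightarrow> (\<exists>f f'. (f, f') \<in> S \<and> P f f' = 0 \<and> (f, a) \<in> G0 \<and> (f, b) \<in> G1)"
proof
  assume "(a, b) \<in> M'"
  then obtain h where h: "(h, z *\<^sub>C h) \<in> block_op A B C D ` S"
      "(h, a) \<in> (W_op A B S)\<inverse> O G0" "(h, b) \<in> (W_op A B S)\<inverse> O G1"
    by (auto simp: weyl_family_def eigenspace_def)
  from h(1) obtain f f' where f: "(f, f') \<in> S" "h = A f + B f'" "z *\<^sub>C h = C f + D f'"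
    by (auto simp: block_op_def)
  have "(f, a) \<in> G0" "(f, b) \<in> G1"
    using h(2,3) by (simp_all only: f(2) mem_transformed_boundary[OF f(1)])
  moreover have "P f f' = 0"
    using f by (simp add: P_def)
  ultimately show "\<exists>f f'. (f, f') \<in> S \<and> P f f' = 0 \<and> (f, a) \<in> G0 \<and> (f, b) \<in> G1"
    using f(1) by blast
next
  assume "\<exists>f f'. (f, f') \<in> S \<and> P f f' = 0 \<and> (f, a) \<in> G0 \<and> (f, b) \<in> G1"
  then obtain f f' where f: "(f, f') \<in> S" "P f f' = 0" "(f, a) \<in> G0" "(f, b) \<in> G1"
    by blast
  have "(A f + B f', C f + D f') \<in> block_op A B C D ` S"
    using f(1) by (force simp: block_op_def)
  then have "A f + B f' \<in> eigenspace (block_op A B C D ` S) z"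
    using f(2) by (simp add: eigenspace_def P_def)
  moreover have "(A f + B f', a) \<in> (W_op A B S)\<inverse> O G0" "(A f + B f', b) \<in> (W_op A B S)\<inverse> O G1"
    using f(3,4) by (simp_all only: mem_transformed_boundary[OF f(1)])
  ultimately show "(a, b) \<in> M'"
    unfolding weyl_family_def by blast
qed

text \<open>Unfolds the composition: f is the value of the gamma-field at a, and u is the correction
  with p_V(z;T_0) u = p_V(z) f. The minus sign of \<open>Delta_V\<close> moves onto d.\<close>

lemma mem_Delta_V:
  "(a, d) \<in> Delta_V A B C D S G0 G1 z \<longleftrightarrow>
    (\<exists>f u u'. (f, z *\<^sub>C f) \<in> S \<and> (f, a) \<in> G0 \<and>
      (u, u') \<in> S \<and> (u, 0) \<in> G0 \<and> P f (z *\<^sub>C f) = P u u' \<and> (u, - d) \<in> G1)"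
proof -
  have "single_valued (restrict_ker S G0)" "single_valued (graph_of (\<lambda>f::'h. z *\<^sub>C f))"
    using S_fun by (auto simp: single_valued_def restrict_ker_def)
  then have mem: "(u, k) \<in> pV_op A B C D z (restrict_ker S G0) \<longleftrightarrow>
      (\<exists>u'. (u, u') \<in> S \<and> (u, 0) \<in> G0 \<and> k = P u u')"
    "(u, k) \<in> pV A B C D z \<longleftrightarrow> k = P u (z *\<^sub>C u)" for u k
    by (simp_all add: pV_def mem_pV_op restrict_ker_def P_def)
  have "(a, d) \<in> Delta_V A B C D S G0 G1 z \<longleftrightarrow>
    (\<exists>f k u. (a, f) \<in> gamma_field S G0 z \<and> (f, k) \<in> pV A B C D z \<and>
      (u, k) \<in> pV_op A B C D z (restrict_ker S G0) \<and> (u, - d) \<in> G1)"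
    unfolding Delta_V_def mem_rel_minus relcomp_unfold by simp
  also have "\<dots> \<longleftrightarrow> (\<exists>f u u'. (f, z *\<^sub>C f) \<in> S \<and> (f, a) \<in> G0 \<and>
      (u, u') \<in> S \<and> (u, 0) \<in> G0 \<and> P f (z *\<^sub>C f) = P u u' \<and> (u, - d) \<in> G1)"
    by (simp add: mem gamma_field_def eigenspace_def) (intro ex_cong1 conj_cong refl, blast)
  finally show ?thesis .
qed

text \<open>Two kernel elements of the pencil with equal \<open>G0\<close> value differ by an
  element of dom T_0, so \<open>P_inj\<close> makes them equal and \<open>M'\<close>
  single-valued.\<close>

lemma linear_op_M': "linear_op M'"
proof -
  have "csubspace M'"
  proof (rule csubspace_graphI)
    show "(0, 0) \<in> M'"
      unfolding mem_M'
      by (intro exI[of _ 0]) (simp add: csubspace_graph_zero S_sub G0_sub G1_sub P_zero)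
  next
    fix a b a' b' assume "(a, b) \<in> M'" "(a', b') \<in> M'"
    then obtain f f' g g' where "(f, f') \<in> S" "P f f' = 0" "(f, a) \<in> G0" "(f, b) \<in> G1"
      "(g, g') \<in> S" "P g g' = 0" "(g, a') \<in> G0" "(g, b') \<in> G1"
      unfolding mem_M' by blast
    then show "(a + a', b + b') \<in> M'"
      unfolding mem_M'
      by (intro exI[of _ "f + g"] exI[of _ "f' + g'"])
        (simp add: csubspace_graph_add S_sub G0_sub G1_sub P_add)
  next
    fix c a b assume "(a, b) \<in> M'"
    then obtain f f' where "(f, f') \<in> S" "P f f' = 0" "(f, a) \<in> G0" "(f, b) \<in> G1"
      unfolding mem_M' by blast
    then show "(c *\<^sub>C a, c *\<^sub>C b) \<in> M'"
      unfolding mem_M'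
      by (intro exI[of _ "c *\<^sub>C f"] exI[of _ "c *\<^sub>C f'"])
        (simp add: csubspace_graph_scaleC S_sub G0_sub G1_sub P_scaleC)
  qed
  moreover have "single_valued M'"
  proof (rule single_valuedI)
    fix a b c assume "(a, b) \<in> M'" "(a, c) \<in> M'"
    then obtain f f' g g' where f: "(f, f') \<in> S" "P f f' = 0" "(f, a) \<in> G0" "(f, b) \<in> G1"
      and g: "(g, g') \<in> S" "P g g' = 0" "(g, a) \<in> G0" "(g, c) \<in> G1"
      unfolding mem_M' by blast
    have "f - g = 0"
      using csubspace_graph_diff[OF S_sub f(1) g(1)] csubspace_graph_diff[OF G0_sub f(3) g(3)]
        f(2) g(2) by (intro P_inj) (auto simp: P_diff)
    then show "b = c"
      using f(4) g(4) G1_fun by simp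
  qed
  ultimately show ?thesis
    by (simp add: linear_op_def)
qed

lemma M'_eq: "M' = rel_add (weyl_family S G0 G1 z) (Delta_V A B C D S G0 G1 z)"
proof (intro equalityI subrelI)
  fix a b assume "(a, b) \<in> M'"
  then obtain g g' where g: "(g, g') \<in> S" "P g g' = 0" "(g, a) \<in> G0" "(g, b) \<in> G1"
    unfolding mem_M' by blast
  obtain f where f: "(f, z *\<^sub>C f) \<in> S" "(f, a) \<in> G0"
    using gamma_exists by blast
  then obtain e where e: "(f, e) \<in> G1"
    using dom_G1 by blast
  \<comment> \<open>Since g is annihilated by the pencil, f - g is the correction u that belongs to
    f.\<close>
  have "(f - g, 0) \<in> G0" "P f (z *\<^sub>C f) = P (f - g) (z *\<^sub>C f - g')"
    using csubspace_graph_diff[OF G0_sub f(2) g(3)] g(2) by (simp_all add: P_diff)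
  moreover have "(f - g, - (b - e)) \<in> G1"
    using csubspace_graph_diff[OF G1_sub e g(4)] by simp
  ultimately have "(a, b - e) \<in> Delta_V A B C D S G0 G1 z"
    using csubspace_graph_diff[OF S_sub f(1) g(1)] f unfolding mem_Delta_V by blast
  moreover have "(a, e) \<in> weyl_family S G0 G1 z"
    using f e by (auto simp: weyl_family_def eigenspace_def)
  ultimately show "(a, b) \<in> rel_add (weyl_family S G0 G1 z) (Delta_V A B C D S G0 G1 z)"
    unfolding rel_add_def by force
next
  fix a b assume "(a, b) \<in> rel_add (weyl_family S G0 G1 z) (Delta_V A B C D S G0 G1 z)"
  then obtain e d where b: "b = e + d" and "(a, e) \<in> weyl_family S G0 G1 z"
      "(a, d) \<in> Delta_V A B C D S G0 G1 z"
    by (auto simp: rel_add_def)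
  then obtain g f u u' where g: "(g, z *\<^sub>C g) \<in> S" "(g, a) \<in> G0" "(g, e) \<in> G1"
    and f: "(f, z *\<^sub>C f) \<in> S" "(f, a) \<in> G0"
    and u: "(u, u') \<in> S" "(u, 0) \<in> G0" "P f (z *\<^sub>C f) = P u u'" "(u, - d) \<in> G1"
    unfolding mem_Delta_V by (auto simp: weyl_family_def eigenspace_def)
  \<comment> \<open>The two summands come with their own eigenvectors for the same a. Their
    difference is an eigenvector of T_0 at z or zero, and the former is excluded.\<close>
  have "f - g = 0"
    using csubspace_graph_diff[OF S_sub f(1) g(1)] csubspace_graph_diff[OF G0_sub f(2) g(2)]
    by (intro T0_eigen_zero) (auto simp: scaleC_diff_right)
  then have "(f, e) \<in> G1"
    using g(3) by simp
  then have "(f - u, b) \<in> G1" "(f - u, a) \<in> G0" "P (f - u) (z *\<^sub>C f - u') = 0"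
    using csubspace_graph_diff[OF G1_sub _ u(4), of f e]
      csubspace_graph_diff[OF G0_sub f(2) u(2)] u(3)
    by (simp_all add: b P_diff)
  then show "(a, b) \<in> M'"
    using csubspace_graph_diff[OF S_sub f(1) u(1)] unfolding mem_M' by blast
qed

text \<open>Surjectivity of the pencil on dom T_0 supplies the correction u for every f, so each a
  is reached by f - u.\<close>

lemma Domain_M': "Domain M' = UNIV"
proof -
  have "a \<in> Domain M'" for a
  proof -
    obtain f where f: "(f, z *\<^sub>C f) \<in> S" "(f, a) \<in> G0"
      using gamma_exists by blast
    obtain u u' where u: "(u, u') \<in> S" "(u, 0) \<in> G0" "P u u' = P f (z *\<^sub>C f)"
      using P_surj by blast
    have "(f - u, z *\<^sub>C f - u') \<in> S"
      using csubspace_graph_diff[OF S_sub f(1) u(1)] .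
    moreover from this obtain b where "(f - u, b) \<in> G1"
      using dom_G1 by blast
    moreover have "(f - u, a) \<in> G0" "P (f - u) (z *\<^sub>C f - u') = 0"
      using csubspace_graph_diff[OF G0_sub f(2) u(2)] u(3) by (simp_all add: P_diff)
    ultimately show ?thesis
      using mem_M' by blast
  qed
  then show ?thesis
    by blast
qed

end

section \<open>Return from the algebraic setting to the Krein spaces\<close>

theorem theorem6p9:
  fixes JH :: "'h::chilbert_space \<Rightarrow> 'h"
    and JK :: "'k::chilbert_space \<Rightarrow> 'k"
    and T T\<^sub>0 :: "('h \<times> 'h) set"
    and T' T\<^sub>0' :: "('k \<times> 'k) set"
    and \<Gamma>\<^sub>0 \<Gamma>\<^sub>1 :: "('h \<times> 'l::chilbert_space) set"
    and \<Gamma>\<^sub>0' \<Gamma>\<^sub>1' :: "('k \<times> 'l) set"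
    and A B C D :: "'h \<Rightarrow> 'k"
    and V :: "'h \<times> 'h \<Rightarrow> 'k \<times> 'k"
    and \<rho>\<^sub>V :: "complex set"
  assumes "fundamental_symmetry JH" and "fundamental_symmetry JK"
    and "linear_op T" and "densely_defined T" and "closed T" and "krein_symmetric JH T"
    and "boundary_triple JH T \<Gamma>\<^sub>0 \<Gamma>\<^sub>1"
    and "bounded_clinear A" and "bounded_clinear B"
    and "bounded_clinear C" and "bounded_clinear D"
    and "V = block_op A B C D"
    and "standard_unitary JH JK V"
    and "single_valued ((W_op A B (krein_adj JH JH T))\<inverse>)"
    and "T' = V ` T"
    and "\<Gamma>\<^sub>0' = (W_op A B (krein_adj JH JH T))\<inverse> O \<Gamma>\<^sub>0"
    and "\<Gamma>\<^sub>1' = (W_op A B (krein_adj JH JH T))\<inverse> O \<Gamma>\<^sub>1"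
    and "T\<^sub>0 = restrict_ker (krein_adj JH JH T) \<Gamma>\<^sub>0"
    and "T\<^sub>0' = restrict_ker (krein_adj JK JK T') \<Gamma>\<^sub>0'"
    and "\<rho>\<^sub>V = resolvent_set T\<^sub>0 \<inter> resolvent_set T\<^sub>0'"
    and "(UNIV - \<real>) \<inter> \<rho>\<^sub>V \<noteq> {}"
  shows "\<forall>z \<in> \<rho>\<^sub>V.
    linear_op (weyl_family (krein_adj JK JK T') \<Gamma>\<^sub>0' \<Gamma>\<^sub>1' z) \<and>
    Domain (weyl_family (krein_adj JK JK T') \<Gamma>\<^sub>0' \<Gamma>\<^sub>1' z) = UNIV \<and>
    weyl_family (krein_adj JK JK T') \<Gamma>\<^sub>0' \<Gamma>\<^sub>1' z =
      rel_add (weyl_family (krein_adj JH JH T) \<Gamma>\<^sub>0 \<Gamma>\<^sub>1 z)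
              (Delta_V A B C D (krein_adj JH JH T) \<Gamma>\<^sub>0 \<Gamma>\<^sub>1 z)"
proof
  fix z assume "z \<in> \<rho>\<^sub>V"
  \<comment> \<open>This brings the adjoint of T' into the image form on which the locale is
    built.\<close>
  have S': "krein_adj JK JK T' = block_op A B C D ` krein_adj JH JH T"
    using krein_adj_image_standard_unitary[OF assms(1,2,13)] assms(12,15) by simp
  have triple: "linear_op \<Gamma>\<^sub>0" "linear_op \<Gamma>\<^sub>1"
      "Domain \<Gamma>\<^sub>0 = Domain (krein_adj JH JH T)" "Domain \<Gamma>\<^sub>1 = Domain (krein_adj JH JH T)"
      "\<And>a. \<exists>f. (f, a) \<in> \<Gamma>\<^sub>0"
    using assms(7) unfolding boundary_triple_def by blast+
  have res: "z \<in> resolvent_set (restrict_ker (krein_adj JH JH T) \<Gamma>\<^sub>0)"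
    "z \<in> resolvent_set (restrict_ker (block_op A B C D ` krein_adj JH JH T)
      ((W_op A B (krein_adj JH JH T))\<inverse> O \<Gamma>\<^sub>0))"
    using \<open>z \<in> \<rho>\<^sub>V\<close> assms(16,18-20) S' by simp_all
  interpret transformed_triple "krein_adj JH JH T" \<Gamma>\<^sub>0 \<Gamma>\<^sub>1 A B C D z
    by (rule transformed_triple.intro)
      (fact linear_op_krein_adj[OF assms(1,4)] triple assms(8-11,14) res)+
  show "linear_op (weyl_family (krein_adj JK JK T') \<Gamma>\<^sub>0' \<Gamma>\<^sub>1' z) \<and>
    Domain (weyl_family (krein_adj JK JK T') \<Gamma>\<^sub>0' \<Gamma>\<^sub>1' z) = UNIV \<and>
    weyl_family (krein_adj JK JK T') \<Gamma>\<^sub>0' \<Gamma>\<^sub>1' z =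
      rel_add (weyl_family (krein_adj JH JH T) \<Gamma>\<^sub>0 \<Gamma>\<^sub>1 z)
              (Delta_V A B C D (krein_adj JH JH T) \<Gamma>\<^sub>0 \<Gamma>\<^sub>1 z)"
    unfolding S' assms(16,17) by (intro conjI linear_op_M' Domain_M' M'_eq)
qed

end
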